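(* Let $(B^n,g_B)$ be a compact Riemannian manifold, $(F^d,g_F)$ a semi-Riemannian manifold with constant scalar curvature $\lambda_F$, $f$ a positive smooth function on $B$, $h\in C^\infty(B)$ and $\widetilde h=h\circ\pi$. Suppose the warped product $\overline M^{n+d}=(B\times F,\overline g)$, $\overline g=\pi^*g_B+(f\circ\pi)^2\sigma^*g_F$, is a gradient Yamabe soliton with potential function $\widetilde h$. Then $\overline M^{n+d}$ is trivial, i.e. $\widetilde h$ is constant.
   Context: Manifolds are connected. $\pi:B\times F\to B$ and $\sigma:B\times F\to F$ are the projections. A semi-Riemannian manifold $(M,g)$ is a gradient Yamabe soliton with potential function $u\in C^\infty(M)$ and soliton constant $\rho\in\mathbb R$ if $(S_g-\rho)g=\mathrm{Hess}_g(u)$, where $S_g$ is the scalar curvature of $g$. It is called trivial if $u$ is constant. *)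

theory Defs
  imports "HOL-Analysis.Analysis"
begin

section \<open>Smooth maps between Euclidean spaces\<close>

text \<open>Only used for open \<open>S\<close>, where \<open>Ck_on k f S\<close> says that \<open>f\<close> is of class \<open>C\<^sup>k\<close> on \<open>S\<close>.\<close>

primrec Ck_on ::
    "nat \<Rightarrow> ('a::euclidean_space \<Rightarrow> 'b::real_normed_vector) \<Rightarrow> 'a set \<Rightarrow> bool" where
  "Ck_on 0 f S \<longleftrightarrow> continuous_on S f"
| "Ck_on (Suc k) f S \<longleftrightarrow>
     (\<forall>x\<in>S. f differentiable (at x)) \<and>
     (\<forall>v. Ck_on k (\<lambda>x. frechet_derivative f (at x) v) S)"

definition smooth_on ::
    "'a::euclidean_space set \<Rightarrow> ('a \<Rightarrow> 'b::real_normed_vector) \<Rightarrow> bool" where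
  "smooth_on S f \<longleftrightarrow> (\<forall>k. Ck_on k f S)"

section \<open>Smooth manifolds\<close>

text \<open>
  A chart is a coordinate domain together with a coordinate map into the model space \<open>'e\<close>; the
  manifold itself is the whole type \<open>'a\<close> and its dimension is \<open>DIM('e)\<close>, which is at least 1.
  A smooth structure is given by any atlas, not necessarily a maximal one; all the notions
  below depend only on the maximal atlas that it generates.
\<close>

type_synonym ('a, 'e) chart = "'a set \<times> ('a \<Rightarrow> 'e)"

abbreviation cdom :: "('a, 'e) chart \<Rightarrow> 'a set" where
  "cdom c \<equiv> fst c"

abbreviation cmap :: "('a, 'e) chart \<Rightarrow> 'a \<Rightarrow> 'e" where
  "cmap c \<equiv> snd c"

definition cinv :: "('a, 'e) chart \<Rightarrow> 'e \<Rightarrow> 'a" where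
  "cinv c = inv_into (cdom c) (cmap c)"

definition smooth_manifold ::
    "('a::{t2_space, second_countable_topology}, 'e::euclidean_space) chart set \<Rightarrow> bool" where
  "smooth_manifold A \<longleftrightarrow>
     connected (UNIV :: 'a set) \<and>
     (\<Union>c\<in>A. cdom c) = UNIV \<and>
     (\<forall>c\<in>A. open (cdom c) \<and> open (cmap c ` cdom c) \<and>
        homeomorphism (cdom c) (cmap c ` cdom c) (cmap c) (cinv c)) \<and>
     (\<forall>c\<in>A. \<forall>c'\<in>A. smooth_on (cmap c ` (cdom c \<inter> cdom c')) (cmap c' \<circ> cinv c))"

definition smooth_fun ::
    "('a::topological_space, 'e::euclidean_space) chart set \<Rightarrow> ('a \<Rightarrow> real) \<Rightarrow> bool" where
  "smooth_fun A u \<longleftrightarrow> (\<forall>c\<in>A. smooth_on (cmap c ` cdom c) (u \<circ> cinv c))"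

definition smooth_near ::
    "('a::topological_space, 'e::euclidean_space) chart set \<Rightarrow> 'a \<Rightarrow> ('a \<Rightarrow> real) \<Rightarrow> bool" where
  "smooth_near A p u \<longleftrightarrow>
     (\<exists>N. open N \<and> p \<in> N \<and> (\<forall>c\<in>A. smooth_on (cmap c ` (N \<inter> cdom c)) (u \<circ> cinv c)))"

definition product_chart :: "('a, 'e) chart \<Rightarrow> ('b, 'f) chart \<Rightarrow> ('a \<times> 'b, 'e \<times> 'f) chart" where
  "product_chart c c' = (cdom c \<times> cdom c', map_prod (cmap c) (cmap c'))"

definition product_atlas ::
    "('a, 'e) chart set \<Rightarrow> ('b, 'f) chart set \<Rightarrow> ('a \<times> 'b, 'e \<times> 'f) chart set" where
  "product_atlas A A' = {product_chart c c' | c c'. c \<in> A \<and> c' \<in> A'}"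

section \<open>Tangent vectors\<close>

text \<open>
  A tangent vector at \<open>p\<close> is a derivation acting on the real functions that are smooth near \<open>p\<close>
  (on all other functions it is set to 0, so that equality of tangent vectors is equality of
  functionals). \<open>chart_vector A c p v\<close> is \<open>\<Sum>i. v\<^sup>i (\<partial>/\<partial>x\<^sup>i)\<close> at \<open>p\<close> for the coordinates
  \<open>x\<close> of \<open>c\<close>. By the chain rule every single chart around \<open>p\<close> yields the whole tangent space.
\<close>

type_synonym 'a tangent = "('a \<Rightarrow> real) \<Rightarrow> real"

definition chart_vector ::
    "('a::topological_space, 'e::euclidean_space) chart set \<Rightarrow> ('a, 'e) chart \<Rightarrow> 'a \<Rightarrow> 'e
      \<Rightarrow> 'a tangent" where
  "chart_vector A c p v =
     (\<lambda>u. if smooth_near A p u then frechet_derivative (u \<circ> cinv c) (at (cmap c p)) v else 0)"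

definition tangent_space ::
    "('a::topological_space, 'e::euclidean_space) chart set \<Rightarrow> 'a \<Rightarrow> 'a tangent set" where
  "tangent_space A p = {chart_vector A c p v | c v. c \<in> A \<and> p \<in> cdom c}"

definition differential ::
    "('b::topological_space, 'f::euclidean_space) chart set \<Rightarrow> ('a \<Rightarrow> 'b) \<Rightarrow> 'a \<Rightarrow> 'a tangent
      \<Rightarrow> 'b tangent" where
  "differential A' \<phi> p X = (\<lambda>u. if smooth_near A' (\<phi> p) u then X (u \<circ> \<phi>) else 0)"

section \<open>Semi-Riemannian metrics\<close>

text \<open>Values of a tensor field outside the tangent spaces are irrelevant.\<close>

type_synonym 'a tensor2 = "'a \<Rightarrow> 'a tangent \<Rightarrow> 'a tangent \<Rightarrow> real"

definition pullback ::
    "('b::topological_space, 'f::euclidean_space) chart set \<Rightarrow> ('a \<Rightarrow> 'b) \<Rightarrow> 'b tensor2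
      \<Rightarrow> 'a tensor2" where
  "pullback A' \<phi> g p X Y = g (\<phi> p) (differential A' \<phi> p X) (differential A' \<phi> p Y)"

text \<open>The component function \<open>g(\<Sum>i. v\<^sup>i \<partial>\<^sub>i, \<Sum>j. w\<^sup>j \<partial>\<^sub>j)\<close> at the point with coordinates \<open>x\<close>.\<close>

definition metric_comp ::
    "('a::topological_space, 'e::euclidean_space) chart set \<Rightarrow> ('a, 'e) chart \<Rightarrow> 'a tensor2
      \<Rightarrow> 'e \<Rightarrow> 'e \<Rightarrow> 'e \<Rightarrow> real" where
  "metric_comp A c g v w x =
     g (cinv c x) (chart_vector A c (cinv c x) v) (chart_vector A c (cinv c x) w)"

text \<open>
  Manifolds being connected, the index of a smooth nondegenerate symmetric tensor field is
  automatically constant.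
\<close>

definition semi_riemannian_manifold ::
    "('a::{t2_space, second_countable_topology}, 'e::euclidean_space) chart set \<Rightarrow> 'a tensor2
      \<Rightarrow> bool" where
  "semi_riemannian_manifold A g \<longleftrightarrow>
     smooth_manifold A \<and>
     (\<forall>p. \<forall>X\<in>tangent_space A p. \<forall>Y\<in>tangent_space A p. g p X Y = g p Y X) \<and>
     (\<forall>p. \<forall>X\<in>tangent_space A p. \<forall>Y\<in>tangent_space A p. \<forall>Z\<in>tangent_space A p. \<forall>a b.
        g p (\<lambda>u. a * X u + b * Y u) Z = a * g p X Z + b * g p Y Z) \<and>
     (\<forall>p. \<forall>X\<in>tangent_space A p. (\<forall>Y\<in>tangent_space A p. g p X Y = 0) \<longrightarrow> X = (\<lambda>u. 0)) \<and>
     (\<forall>c\<in>A. \<forall>v w. smooth_on (cmap c ` cdom c) (metric_comp A c g v w))"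

definition riemannian_manifold ::
    "('a::{t2_space, second_countable_topology}, 'e::euclidean_space) chart set \<Rightarrow> 'a tensor2
      \<Rightarrow> bool" where
  "riemannian_manifold A g \<longleftrightarrow>
     semi_riemannian_manifold A g \<and>
     (\<forall>p. \<forall>X\<in>tangent_space A p. X \<noteq> (\<lambda>u. 0) \<longrightarrow> g p X X > 0)"

definition warped_metric ::
    "('b::topological_space, 'e::euclidean_space) chart set
      \<Rightarrow> ('f::topological_space, 'd::euclidean_space) chart set
      \<Rightarrow> 'b tensor2 \<Rightarrow> ('b \<Rightarrow> real) \<Rightarrow> 'f tensor2 \<Rightarrow> ('b \<times> 'f) tensor2" where
  "warped_metric AB AF gB f gF p X Y =
     pullback AB fst gB p X Y + ((f \<circ> fst) p)\<^sup>2 * pullback AF snd gF p X Y"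

section \<open>Curvature and Hessian in local coordinates\<close>

text \<open>
  Indices range over \<open>Basis\<close>; the argument \<open>x\<close> is a point of the coordinate image of the chart.
\<close>

definition pd :: "'e::euclidean_space \<Rightarrow> ('e \<Rightarrow> real) \<Rightarrow> 'e \<Rightarrow> real" where
  "pd i F x = frechet_derivative F (at x) i"

text \<open>
  \<open>g\<^sup>k\<^sup>l\<close>, the inverse of the matrix \<open>g\<^sub>i\<^sub>j\<close>, read off from the inverse of the linear map
  \<open>v \<mapsto> \<Sum>j. g(v, \<partial>\<^sub>j) j\<close> of the model space.
\<close>

definition metric_inv ::
    "('a::topological_space, 'e::euclidean_space) chart set \<Rightarrow> ('a, 'e) chart \<Rightarrow> 'a tensor2
      \<Rightarrow> 'e \<Rightarrow> 'e \<Rightarrow> 'e \<Rightarrow> real" where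
  "metric_inv A c g k l x = inv (\<lambda>v. \<Sum>j\<in>Basis. metric_comp A c g v j x *\<^sub>R j) l \<bullet> k"

text \<open>\<open>christoffel A c g k i j\<close> is \<open>\<Gamma>\<^sup>k\<^sub>i\<^sub>j\<close>.\<close>

definition christoffel ::
    "('a::topological_space, 'e::euclidean_space) chart set \<Rightarrow> ('a, 'e) chart \<Rightarrow> 'a tensor2
      \<Rightarrow> 'e \<Rightarrow> 'e \<Rightarrow> 'e \<Rightarrow> 'e \<Rightarrow> real" where
  "christoffel A c g k i j x =
     (1 / 2) * (\<Sum>l\<in>Basis. metric_inv A c g k l x *
        (pd i (metric_comp A c g j l) x + pd j (metric_comp A c g i l) x
          - pd l (metric_comp A c g i j) x))"

text \<open>
  \<open>riemann A c g l k i j\<close> is the coefficient of \<open>\<partial>\<^sub>l\<close> in \<open>R(\<partial>\<^sub>i, \<partial>\<^sub>j) \<partial>\<^sub>k\<close>, where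
  \<open>R(X, Y) Z = \<nabla>\<^sub>X \<nabla>\<^sub>Y Z - \<nabla>\<^sub>Y \<nabla>\<^sub>X Z - \<nabla>\<^bsub>[X, Y]\<^esub> Z\<close>. With the trace below, round spheres have
  positive scalar curvature.
\<close>

definition riemann ::
    "('a::topological_space, 'e::euclidean_space) chart set \<Rightarrow> ('a, 'e) chart \<Rightarrow> 'a tensor2
      \<Rightarrow> 'e \<Rightarrow> 'e \<Rightarrow> 'e \<Rightarrow> 'e \<Rightarrow> 'e \<Rightarrow> real" where
  "riemann A c g l k i j x =
     pd i (christoffel A c g l j k) x - pd j (christoffel A c g l i k) x
     + (\<Sum>m\<in>Basis. christoffel A c g l i m x * christoffel A c g m j k x
                   - christoffel A c g l j m x * christoffel A c g m i k x)"

definition ricci ::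
    "('a::topological_space, 'e::euclidean_space) chart set \<Rightarrow> ('a, 'e) chart \<Rightarrow> 'a tensor2
      \<Rightarrow> 'e \<Rightarrow> 'e \<Rightarrow> 'e \<Rightarrow> real" where
  "ricci A c g j k x = (\<Sum>i\<in>Basis. riemann A c g i k i j x)"

text \<open>
  Scalar curvature at \<open>p\<close> and Hessian at \<open>p\<close>, computed in the chart \<open>c\<close> around \<open>p\<close>. The values
  do not depend on \<open>c\<close>; statements about them are made for every chart of the atlas.
\<close>

definition scalar_curvature ::
    "('a::topological_space, 'e::euclidean_space) chart set \<Rightarrow> ('a, 'e) chart \<Rightarrow> 'a tensor2
      \<Rightarrow> 'a \<Rightarrow> real" where
  "scalar_curvature A c g p =
     (\<Sum>j\<in>Basis. \<Sum>k\<in>Basis. metric_inv A c g j k (cmap c p) * ricci A c g j k (cmap c p))"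

text \<open>
  The tangent vector \<open>X\<close> has the components \<open>X(x\<^sup>i)\<close>, where \<open>x\<^sup>i = (\<lambda>q. cmap c q \<bullet> i)\<close>.
\<close>

definition hessian ::
    "('a::topological_space, 'e::euclidean_space) chart set \<Rightarrow> ('a, 'e) chart \<Rightarrow> 'a tensor2
      \<Rightarrow> ('a \<Rightarrow> real) \<Rightarrow> 'a tensor2" where
  "hessian A c g u p X Y =
     (\<Sum>i\<in>Basis. \<Sum>j\<in>Basis. X (\<lambda>q. cmap c q \<bullet> i) * Y (\<lambda>q. cmap c q \<bullet> j) *
        (pd i (pd j (u \<circ> cinv c)) (cmap c p)
          - (\<Sum>k\<in>Basis. christoffel A c g k i j (cmap c p) * pd k (u \<circ> cinv c) (cmap c p))))"

definition constant_scalar_curvature ::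
    "('a::topological_space, 'e::euclidean_space) chart set \<Rightarrow> 'a tensor2 \<Rightarrow> real \<Rightarrow> bool" where
  "constant_scalar_curvature A g s \<longleftrightarrow>
     (\<forall>c\<in>A. \<forall>p\<in>cdom c. scalar_curvature A c g p = s)"

section \<open>Gradient Yamabe solitons\<close>

definition gradient_yamabe_soliton ::
    "('a::{t2_space, second_countable_topology}, 'e::euclidean_space) chart set \<Rightarrow> 'a tensor2
      \<Rightarrow> ('a \<Rightarrow> real) \<Rightarrow> real \<Rightarrow> bool" where
  "gradient_yamabe_soliton A g u \<rho> \<longleftrightarrow>
     semi_riemannian_manifold A g \<and> smooth_fun A u \<and>
     (\<forall>c\<in>A. \<forall>p\<in>cdom c. \<forall>X\<in>tangent_space A p. \<forall>Y\<in>tangent_space A p.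
        (scalar_curvature A c g p - \<rho>) * g p X Y = hessian A c g u p X Y)"

definition trivial_potential :: "('a \<Rightarrow> real) \<Rightarrow> bool" where
  "trivial_potential u \<longleftrightarrow> u constant_on UNIV"

end

theory Submission
  imports Defs
begin

text \<open>
  Write \<open>u = h \<circ> \<pi>\<close>, \<open>\<sigma> = S - \<rho>\<close> and \<open>M = B \<times> F\<close>. The soliton equation \<open>Hess u = \<sigma> g\<close> says that,
  in every chart,
  \<open>\<partial>\<^sub>i \<partial>\<^sub>j u = \<sigma> g\<^sub>i\<^sub>j + \<Sum>k. \<Gamma>\<^sup>k\<^sub>i\<^sub>j \<partial>\<^sub>k u\<close>.
  What \<open>\<sigma>\<close> is can be read off from the fibre directions. There all second partial derivatives of
  \<open>u\<close> vanish, because \<open>u\<close> is constant along the fibres, so that for vertical \<open>a\<close>, \<open>b\<close> the equation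
  becomes \<open>\<sigma> g(a, b) = - \<Sum>k. \<Gamma>\<^sup>k(a, b) \<partial>\<^sub>k u\<close>. The restriction of \<open>g\<close> to a fibre is \<open>f\<^sup>2 g\<^sub>F\<close>,
  which is nondegenerate, so \<open>a\<close> and \<open>b\<close> can be chosen with \<open>g(a, b) \<noteq> 0\<close>. Hence \<open>\<sigma>\<close> is a linear
  expression in the first derivatives of \<open>u\<close> with locally bounded coefficients; in invariant terms,
  \<open>\<sigma> = \<langle>\<nabla>f, \<nabla>h\<rangle> / f\<close>.

  Inserting this back, every second partial derivative of \<open>u\<close> is locally bounded by a multiple of
  the norm of its gradient (\<open>conformal_hessian_dominated\<close>). The gradient therefore satisfies a
  homogeneous linear differential inequality along every segment, and if it vanishes at one point of a coordinate
  ball, it vanishes on the whole ball (\<open>vanishes_if_derivative_dominated\<close>). So the set of critical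
  points of \<open>u\<close> at which \<open>u\<close> takes a given value is open and closed. For the value \<open>max h\<close>, which is
  attained since \<open>B\<close> is compact, it is nonempty, and \<open>M\<close> is connected: \<open>u\<close> is constant
  (\<open>constant_if_hessian_locally_dominated\<close>).
\<close>

section \<open>Calculus of smooth functions\<close>

lemma Ck_on_cong:
  fixes S :: "'a::euclidean_space set" and f g :: "'a \<Rightarrow> 'b::real_normed_vector"
  assumes "open S" "\<And>x. x \<in> S \<Longrightarrow> f x = g x" "Ck_on k f S"
  shows "Ck_on k g S"
  using assms(2,3)
proof (induction k arbitrary: f g)
  case 0
  then show ?case using continuous_on_eq[of S f g] by simp
next
  case (Suc k)
  have diff: "f differentiable (at x)" if "x \<in> S" for x
    using Suc.prems(2) that by simp
  have "frechet_derivative f (at x) = frechet_derivative g (at x)" if "x \<in> S" for x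
    by (rule frechet_derivative_transform_within_open[OF diff[OF that] assms(1) that Suc.prems(1)])
  then have "Ck_on k (\<lambda>x. frechet_derivative g (at x) v) S" for v
    using Suc.IH[of "\<lambda>x. frechet_derivative f (at x) v" "\<lambda>x. frechet_derivative g (at x) v"]
      Suc.prems(2) by simp
  moreover have "g differentiable (at x)" if "x \<in> S" for x
  proof -
    have "(f has_derivative frechet_derivative f (at x)) (at x)"
      using diff[OF that] by (simp add: frechet_derivative_works[symmetric])
    then have "(g has_derivative frechet_derivative f (at x)) (at x)"
      by (rule has_derivative_transform_within_open[OF _ assms(1) that Suc.prems(1)])
    then show ?thesis by (rule differentiableI)
  qed
  ultimately show ?case by simp
qed

lemma Ck_on_mono:
  assumes "Ck_on k f S" "T \<subseteq> S"
  shows "Ck_on k f T"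
  using assms(1)
proof (induction k arbitrary: f)
  case 0
  then show ?case using assms(2) continuous_on_subset by auto
next
  case (Suc k)
  then show ?case using assms(2) by auto
qed

lemma Ck_on_linear_left:
  fixes f :: "'a::euclidean_space \<Rightarrow> 'b::real_normed_vector"
  assumes "bounded_linear L" "open S" "Ck_on k f S"
  shows "Ck_on k (\<lambda>x. L (f x)) S"
  using assms(3)
proof (induction k arbitrary: f)
  case 0
  then show ?case using bounded_linear.continuous_on[OF assms(1)] by simp
next
  case (Suc k)
  have der: "((\<lambda>x. L (f x)) has_derivative (\<lambda>v. L (frechet_derivative f (at x) v))) (at x)"
    if "x \<in> S" for x
  proof -
    have "(f has_derivative frechet_derivative f (at x)) (at x)"
      using Suc.prems that by (auto simp: frechet_derivative_works[symmetric])
    then show ?thesis by (rule bounded_linear.has_derivative[OF assms(1)])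
  qed
  have "Ck_on k (\<lambda>x. frechet_derivative (\<lambda>x. L (f x)) (at x) v) S" for v
  proof (rule Ck_on_cong[OF assms(2)])
    show "Ck_on k (\<lambda>x. L (frechet_derivative f (at x) v)) S"
      using Suc.IH Suc.prems by simp
    show "L (frechet_derivative f (at x) v) = frechet_derivative (\<lambda>x. L (f x)) (at x) v"
      if "x \<in> S" for x
      using frechet_derivative_at[OF der[OF that]] by metis
  qed
  then show ?case using differentiableI[OF der] unfolding Ck_on.simps by blast
qed

lemma Ck_on_linear_right:
  fixes f :: "'a::euclidean_space \<Rightarrow> 'b::real_normed_vector"
    and L :: "'c::euclidean_space \<Rightarrow> 'a"
  assumes "bounded_linear L" "open T" "L ` T \<subseteq> S" "Ck_on k f S"
  shows "Ck_on k (\<lambda>x. f (L x)) T"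
  using assms(4)
proof (induction k arbitrary: f)
  case 0
  then show ?case
    using continuous_on_compose2[OF _ linear_continuous_on[OF assms(1)] assms(3)] by auto
next
  case (Suc k)
  have der: "((\<lambda>x. f (L x)) has_derivative (\<lambda>v. frechet_derivative f (at (L x)) (L v))) (at x)"
    if "x \<in> T" for x
  proof -
    have "(f has_derivative frechet_derivative f (at (L x))) (at (L x))"
      using Suc.prems assms(3) that by (auto simp: frechet_derivative_works[symmetric])
    from has_derivative_compose[OF bounded_linear_imp_has_derivative[OF assms(1)] this]
    show ?thesis by simp
  qed
  have "Ck_on k (\<lambda>x. frechet_derivative (\<lambda>x. f (L x)) (at x) v) T" for v
  proof (rule Ck_on_cong[OF assms(2)])
    show "Ck_on k (\<lambda>x. frechet_derivative f (at (L x)) (L v)) T"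
      using Suc.IH[of "\<lambda>x. frechet_derivative f (at x) (L v)"] Suc.prems by simp
    show "frechet_derivative f (at (L x)) (L v) = frechet_derivative (\<lambda>x. f (L x)) (at x) v"
      if "x \<in> T" for x
      using frechet_derivative_at[OF der[OF that]] by metis
  qed
  then show ?case using differentiableI[OF der] unfolding Ck_on.simps by blast
qed

lemma smooth_on_differentiable:
  assumes "smooth_on S f" "x \<in> S"
  shows "f differentiable (at x)"
  using assms Ck_on.simps(2)[of 0 f S] unfolding smooth_on_def by metis

lemma smooth_on_continuous:
  assumes "smooth_on S f"
  shows "continuous_on S f"
  using assms Ck_on.simps(1)[of f S] unfolding smooth_on_def by metis

lemma smooth_on_pd:
  assumes "smooth_on S f"
  shows "smooth_on S (pd i f)"
  using assms Ck_on.simps(2)[of _ f S] unfolding smooth_on_def pd_def[abs_def] by metis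

lemma pd_zero_if_constant_in_direction:
  assumes "open S" "z \<in> S" "F differentiable (at z)"
    and const: "\<And>t. z + t *\<^sub>R v \<in> S \<Longrightarrow> F (z + t *\<^sub>R v) = F z"
  shows "pd v F z = 0"
proof -
  let ?D = "frechet_derivative F (at z)"
  have D: "(F has_derivative ?D) (at z)"
    using assms(3) by (simp add: frechet_derivative_works)
  have line: "((\<lambda>t. z + t *\<^sub>R v) has_derivative (\<lambda>t. t *\<^sub>R v)) (at (0::real))"
    by (auto intro!: derivative_eq_intros)
  have "((\<lambda>t. F (z + t *\<^sub>R v)) has_derivative (\<lambda>t. ?D (t *\<^sub>R v))) (at (0::real))"
    using has_derivative_compose[OF line, of F ?D] D by simp
  moreover have "((\<lambda>t. F (z + t *\<^sub>R v)) has_derivative (\<lambda>t. 0)) (at (0::real))"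
  proof (rule has_derivative_transform_within_open[where s = "(\<lambda>t. z + t *\<^sub>R v) -` S"])
    show "open ((\<lambda>t. z + t *\<^sub>R v) -` S)"
      by (intro open_vimage assms(1) continuous_intros)
    show "((\<lambda>t. F z) has_derivative (\<lambda>t. 0)) (at (0::real))"
      by simp
  qed (use assms(2) const in auto)
  ultimately have "(\<lambda>t. ?D (t *\<^sub>R v)) = (\<lambda>t. 0)"
    by (rule has_derivative_unique)
  from fun_cong[OF this, of 1] show ?thesis by (simp add: pd_def)
qed

lemma frechet_derivative_sum_pd:
  assumes "F differentiable (at x)"
  shows "frechet_derivative F (at x) v = (\<Sum>i\<in>Basis. (v \<bullet> i) * pd i F x)"
proof -
  have lin: "linear (frechet_derivative F (at x))"
    by (rule linear_frechet_derivative[OF assms])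
  have "frechet_derivative F (at x) v = frechet_derivative F (at x) (\<Sum>i\<in>Basis. (v \<bullet> i) *\<^sub>R i)"
    by (simp add: euclidean_representation)
  also have "\<dots> = (\<Sum>i\<in>Basis. (v \<bullet> i) * pd i F x)"
    by (simp add: linear_sum[OF lin] linear_scale[OF lin] pd_def)
  finally show ?thesis .
qed

section \<open>Unique continuation\<close>

text \<open>
  Gronwall's argument: along a segment from \<open>x\<close>, the
  squared norm of \<open>G\<close> grows at most exponentially, so it stays 0 once it is 0.
\<close>

lemma vanishes_if_derivative_dominated:
  fixes G :: "'e::real_normed_vector \<Rightarrow> 'w::real_inner"
  assumes "convex S"
    and der: "\<And>x. x \<in> S \<Longrightarrow> (G has_derivative G' x) (at x)"
    and bound: "\<And>x v. x \<in> S \<Longrightarrow> norm (G' x v) \<le> C * norm (G x) * norm v"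
    and "x \<in> S" "G x = 0" "y \<in> S"
  shows "G y = 0"
proof -
  define \<gamma> where "\<gamma> t = x + t *\<^sub>R (y - x)" for t :: real
  define c where "c = C * norm (y - x)"
  (* c bounds the logarithmic growth rate of norm (G (\<gamma> t)), so \<phi> is nonincreasing. *)
  define \<phi> where "\<phi> t = exp (- 2 * c * t) * (G (\<gamma> t) \<bullet> G (\<gamma> t))" for t
  have in_S: "\<gamma> t \<in> S" if "t \<in> {0..1}" for t
  proof -
    have "\<gamma> t = (1 - t) *\<^sub>R x + t *\<^sub>R y"
      by (simp add: \<gamma>_def algebra_simps)
    then show ?thesis using convexD_alt[OF assms(1,4,6)] that by auto
  qed
  have "\<phi> 1 \<le> \<phi> 0"
  proof (rule DERIV_nonpos_imp_nonincreasing, simp)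
    fix t :: real assume t: "0 \<le> t" "t \<le> 1"
    let ?D = "G' (\<gamma> t)"
    have D: "(G has_derivative ?D) (at (\<gamma> t))"
      using der[OF in_S[of t]] t by simp
    have "(\<gamma> has_derivative (\<lambda>s. s *\<^sub>R (y - x))) (at t)"
      unfolding \<gamma>_def by (auto intro!: derivative_eq_intros)
    from has_derivative_compose[OF this D]
    have "((\<lambda>t. G (\<gamma> t)) has_vector_derivative ?D (y - x)) (at t)"
      by (simp add: has_vector_derivative_def linear_scale[OF has_derivative_linear[OF D]])
    then have G\<gamma>: "((\<lambda>t. G (\<gamma> t) \<bullet> G (\<gamma> t)) has_real_derivative
        2 * (G (\<gamma> t) \<bullet> ?D (y - x))) (at t)"
      unfolding has_vector_derivative_def has_field_derivative_def
      by (auto intro!: derivative_eq_intros simp: inner_commute fun_eq_iff)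
    have "(\<phi> has_real_derivative exp (- 2 * c * t) *
        (2 * (G (\<gamma> t) \<bullet> ?D (y - x)) - 2 * c * (G (\<gamma> t) \<bullet> G (\<gamma> t)))) (at t)"
      unfolding \<phi>_def by (auto intro!: derivative_eq_intros G\<gamma> simp: algebra_simps)
    moreover have "G (\<gamma> t) \<bullet> G' (\<gamma> t) (y - x) \<le> c * (G (\<gamma> t) \<bullet> G (\<gamma> t))"
    proof -
      have "G (\<gamma> t) \<bullet> G' (\<gamma> t) (y - x) \<le> norm (G (\<gamma> t)) * norm (G' (\<gamma> t) (y - x))"
        by (rule norm_cauchy_schwarz)
      also have "\<dots> \<le> norm (G (\<gamma> t)) * (C * norm (G (\<gamma> t)) * norm (y - x))"
        using bound[OF in_S[of t], of "y - x"] t by (intro mult_left_mono) auto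
      also have "\<dots> = c * (G (\<gamma> t) \<bullet> G (\<gamma> t))"
        by (simp add: c_def dot_square_norm power2_eq_square)
      finally show ?thesis .
    qed
    ultimately show "\<exists>d. (\<phi> has_real_derivative d) (at t) \<and> d \<le> 0"
      by (intro exI conjI) (auto simp: mult_le_0_iff)
  qed
  then have "exp (- 2 * c) * (G y \<bullet> G y) \<le> 0"
    using assms(5) by (simp add: \<phi>_def \<gamma>_def)
  then show ?thesis
    by (metis exp_gt_zero inner_ge_zero inner_eq_zero_iff mult_le_0_iff not_less order_antisym)
qed

text \<open>
  The gradient with respect to the Euclidean metric of the model space. It only serves to measure
  the size of the differential in a chart.
\<close>

definition egrad :: "('e::euclidean_space \<Rightarrow> real) \<Rightarrow> 'e \<Rightarrow> 'e" where
  "egrad F x = (\<Sum>k\<in>Basis. pd k F x *\<^sub>R k)"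

lemma egrad_component: "k \<in> Basis \<Longrightarrow> egrad F x \<bullet> k = pd k F x"
  by (simp add: egrad_def)

lemma egrad_eq_0_iff: "egrad F x = 0 \<longleftrightarrow> (\<forall>k\<in>Basis. pd k F x = 0)"
  by (metis egrad_component euclidean_all_zero_iff)

lemma constant_if_hessian_dominated:
  fixes F :: "'e::euclidean_space \<Rightarrow> real"
  assumes smooth: "smooth_on W F" and "S \<subseteq> W" "convex S"
    and bound: "\<And>x i j. x \<in> S \<Longrightarrow> i \<in> Basis \<Longrightarrow> j \<in> Basis
        \<Longrightarrow> \<bar>pd i (pd j F) x\<bar> \<le> C * norm (egrad F x)"
    and "x \<in> S" "egrad F x = 0" "y \<in> S"
  shows "egrad F y = 0" "F y = F x"
proof -
  let ?n = "real DIM('e)"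
  have D: "(G has_derivative frechet_derivative G (at z)) (at z)"
    if "smooth_on W G" "z \<in> S" for G :: "'e \<Rightarrow> real" and z
    using smooth_on_differentiable[OF that(1)] that(2) assms(2)
    by (auto simp: frechet_derivative_works[symmetric])
  have grad: "egrad F z = 0" if "z \<in> S" for z
  proof (rule vanishes_if_derivative_dominated[where S = S and G = "egrad F" and x = x and
        G' = "\<lambda>z v. \<Sum>k\<in>Basis. frechet_derivative (pd k F) (at z) v *\<^sub>R k" and
        C = "?n * ?n * C"])
    fix z assume z: "z \<in> S"
    let ?D = "\<lambda>v. \<Sum>k\<in>Basis. frechet_derivative (pd k F) (at z) v *\<^sub>R k"
    show "(egrad F has_derivative ?D) (at z)"
      unfolding egrad_def
      by (intro has_derivative_sum has_derivative_scaleR_left D z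
          smooth_on_pd smooth)
    fix v
    have "norm (?D v) \<le> (\<Sum>k\<in>Basis. \<bar>frechet_derivative (pd k F) (at z) v\<bar>)"
      by (intro sum_norm_le) simp
    also have "\<dots> \<le> (\<Sum>k\<in>(Basis::'e set). \<Sum>i\<in>(Basis::'e set). norm v * (C * norm (egrad F z)))"
    proof (rule sum_mono)
      fix k :: 'e assume k: "k \<in> Basis"
      have "frechet_derivative (pd k F) (at z) v = (\<Sum>i\<in>Basis. (v \<bullet> i) * pd i (pd k F) z)"
        using smooth_on_differentiable[OF smooth_on_pd[OF smooth]] assms(2) z
        by (intro frechet_derivative_sum_pd) auto
      also have "\<bar>\<dots>\<bar> \<le> (\<Sum>i\<in>Basis. \<bar>(v \<bullet> i) * pd i (pd k F) z\<bar>)"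
        by (rule sum_abs)
      also have "\<dots> \<le> (\<Sum>i\<in>(Basis::'e set). norm v * (C * norm (egrad F z)))"
        using bound[OF z _ k] Basis_le_norm[of _ v]
        by (intro sum_mono) (auto simp: abs_mult intro!: mult_mono)
      finally show "\<bar>frechet_derivative (pd k F) (at z) v\<bar> \<le> \<dots>" .
    qed
    also have "\<dots> = (?n * ?n * C) * norm (egrad F z) * norm v"
      by simp
    finally show "norm (?D v) \<le> (?n * ?n * C) * norm (egrad F z) * norm v" .
  qed (use assms that in auto)
  show "egrad F y = 0"
    by (rule grad[OF assms(7)])
  have "(F has_derivative (\<lambda>v. 0)) (at z within S)" if z: "z \<in> S" for z
  proof -
    have "frechet_derivative F (at z) v = 0" for v
      using grad[OF z] smooth_on_differentiable[OF smooth] assms(2) z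
      by (subst frechet_derivative_sum_pd) (auto simp: egrad_eq_0_iff)
    then have "frechet_derivative F (at z) = (\<lambda>v. 0)" by auto
    then show ?thesis using has_derivative_at_withinI[OF D[OF smooth z]] by metis
  qed
  from has_derivative_zero_unique[OF assms(3) this assms(5,7)]
  show "F y = F x" ..
qed

section \<open>Charts and tangent vectors\<close>

context
  fixes A :: "('a::{t2_space, second_countable_topology}, 'e::euclidean_space) chart set"
  assumes mf: "smooth_manifold A"
begin

lemma chart_homeomorphism:
  assumes "c \<in> A"
  shows "homeomorphism (cdom c) (cmap c ` cdom c) (cmap c) (cinv c)"
    and "open (cdom c)" and "open (cmap c ` cdom c)"
  using mf assms unfolding smooth_manifold_def by auto

lemma cinv_cmap: "c \<in> A \<Longrightarrow> p \<in> cdom c \<Longrightarrow> cinv c (cmap c p) = p"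
  using chart_homeomorphism(1) homeomorphism_apply1 by metis

lemma chart_around: "\<exists>c\<in>A. p \<in> cdom c"
  using mf unfolding smooth_manifold_def by blast

lemma open_chart_image:
  assumes "c \<in> A" "open N"
  shows "open (cmap c ` (N \<inter> cdom c))"
proof -
  have "openin (top_of_set (cdom c)) (N \<inter> cdom c)"
    using assms(2) openin_open_Int[of N "cdom c"] by (simp add: Int_commute)
  from homeomorphism_imp_open_map[OF chart_homeomorphism(1)[OF assms(1)] this]
  show ?thesis
    using chart_homeomorphism(3)[OF assms(1)] openin_open_eq by blast
qed

lemma open_chart_preimage:
  assumes "c \<in> A" "open W"
  shows "open (cmap c -` W \<inter> cdom c)"
  using continuous_open_vimage chart_homeomorphism[OF assms(1)] assms(2)
  by (metis Int_commute continuous_on_open_vimage homeomorphism_cont1)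

lemma smooth_near_differentiable:
  assumes "smooth_near A p u" "c \<in> A" "p \<in> cdom c"
  shows "(u \<circ> cinv c) differentiable (at (cmap c p))"
proof -
  obtain N where "p \<in> N" "smooth_on (cmap c ` (N \<inter> cdom c)) (u \<circ> cinv c)"
    using assms(1,2) unfolding smooth_near_def by blast
  then show ?thesis using smooth_on_differentiable assms(3) by blast
qed

lemma smooth_fun_near: "smooth_fun A u \<Longrightarrow> smooth_near A p u"
  unfolding smooth_fun_def smooth_near_def by (rule exI[of _ UNIV]) auto

lemma smooth_fun_continuous:
  assumes "smooth_fun A u"
  shows "continuous_on UNIV u"
proof -
  have "isCont u p" for p
  proof -
    obtain c where c: "c \<in> A" "p \<in> cdom c" using chart_around by blast
    have "continuous_on (cdom c) ((u \<circ> cinv c) \<circ> cmap c)"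
      using assms c(1) homeomorphism_cont1[OF chart_homeomorphism(1)[OF c(1)]]
      by (intro continuous_on_compose smooth_on_continuous) (auto simp: smooth_fun_def)
    then have "continuous_on (cdom c) u"
      by (rule continuous_on_eq) (simp add: cinv_cmap[OF c(1)])
    then show ?thesis
      using chart_homeomorphism(2)[OF c(1)] c(2) continuous_on_eq_continuous_at by blast
  qed
  then show ?thesis by (simp add: continuous_on_eq_continuous_at)
qed

lemma smooth_near_coordinate:
  assumes "c \<in> A" "p \<in> cdom c"
  shows "smooth_near A p (\<lambda>q. cmap c q \<bullet> i)"
  unfolding smooth_near_def
proof (intro exI[of _ "cdom c"] conjI ballI)
  fix c' assume c': "c' \<in> A"
  have "smooth_on (cmap c' ` (cdom c' \<inter> cdom c)) (cmap c \<circ> cinv c')"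
    using mf assms(1) c' unfolding smooth_manifold_def by blast
  then have sm: "smooth_on (cmap c' ` (cdom c \<inter> cdom c')) (cmap c \<circ> cinv c')"
    by (simp add: Int_commute)
  show "smooth_on (cmap c' ` (cdom c \<inter> cdom c')) ((\<lambda>q. cmap c q \<bullet> i) \<circ> cinv c')"
    unfolding smooth_on_def
  proof
    fix k
    show "Ck_on k ((\<lambda>q. cmap c q \<bullet> i) \<circ> cinv c') (cmap c' ` (cdom c \<inter> cdom c'))"
      using Ck_on_linear_left[OF bounded_linear_inner_left[of i]
          open_chart_image[OF c' chart_homeomorphism(2)[OF assms(1)]], of k "cmap c \<circ> cinv c'"] sm
      by (simp add: smooth_on_def comp_def)
  qed
qed (use assms chart_homeomorphism in auto)

lemma chart_vector_coordinate:
  assumes "c \<in> A" "p \<in> cdom c"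
  shows "chart_vector A c p v (\<lambda>q. cmap c q \<bullet> i) = v \<bullet> i"
proof -
  have "((\<lambda>x. x \<bullet> i) has_derivative (\<lambda>v. v \<bullet> i)) (at (cmap c p))"
    by (auto intro!: derivative_eq_intros)
  then have "(((\<lambda>q. cmap c q \<bullet> i) \<circ> cinv c) has_derivative (\<lambda>v. v \<bullet> i)) (at (cmap c p))"
    by (rule has_derivative_transform_within_open[OF _ chart_homeomorphism(3)[OF assms(1)]])
      (use assms cinv_cmap[OF assms(1)] in auto)
  from frechet_derivative_at[OF this, symmetric] show ?thesis
    by (simp add: chart_vector_def smooth_near_coordinate[OF assms])
qed

lemma chart_vector_linear:
  assumes "c \<in> A" "p \<in> cdom c"
  shows "chart_vector A c p (a *\<^sub>R v + b *\<^sub>R w)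
    = (\<lambda>u. a * chart_vector A c p v u + b * chart_vector A c p w u)"
  using linear_frechet_derivative[OF smooth_near_differentiable[OF _ assms]]
  by (auto simp: chart_vector_def linear_add linear_scale)

lemma chart_vector_tangent:
  "c \<in> A \<Longrightarrow> p \<in> cdom c \<Longrightarrow> chart_vector A c p v \<in> tangent_space A p"
  unfolding tangent_space_def by blast

text \<open>
  The chain rule: a coordinate vector of another chart \<open>c'\<close> is carried to \<open>c\<close> by the derivative of the
  transition map.
\<close>

lemma tangent_space_chart:
  assumes "c \<in> A" "p \<in> cdom c"
  shows "tangent_space A p = range (chart_vector A c p)"
proof (intro equalityI subsetI)
  fix X assume "X \<in> tangent_space A p"
  then obtain c' w where c': "c' \<in> A" "p \<in> cdom c'" and X: "X = chart_vector A c' p w"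
    unfolding tangent_space_def by blast
  let ?\<tau> = "cmap c \<circ> cinv c'" and ?U = "cmap c' ` (cdom c' \<inter> cdom c)"
  define v where "v = frechet_derivative ?\<tau> (at (cmap c' p)) w"
  have "smooth_on ?U ?\<tau>"
    using mf assms(1) c' unfolding smooth_manifold_def by blast
  then have \<tau>: "(?\<tau> has_derivative frechet_derivative ?\<tau> (at (cmap c' p))) (at (cmap c' p))"
    using smooth_on_differentiable[of ?U ?\<tau> "cmap c' p"] c'(2) assms(2)
    by (auto simp: frechet_derivative_works[symmetric])
  have "X u = chart_vector A c p v u" for u
  proof (cases "smooth_near A p u")
    case True
    let ?D = "frechet_derivative (u \<circ> cinv c) (at (cmap c p))"
    have "((u \<circ> cinv c) has_derivative ?D) (at (?\<tau> (cmap c' p)))"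
      using smooth_near_differentiable[OF True assms] cinv_cmap[OF c']
      by (simp add: frechet_derivative_works[symmetric])
    from has_derivative_compose[OF \<tau> this]
    have "((\<lambda>x. (u \<circ> cinv c) (?\<tau> x)) has_derivative
        (\<lambda>w. ?D (frechet_derivative ?\<tau> (at (cmap c' p)) w))) (at (cmap c' p))" .
    then have "((u \<circ> cinv c') has_derivative
        (\<lambda>w. ?D (frechet_derivative ?\<tau> (at (cmap c' p)) w))) (at (cmap c' p))"
    proof (rule has_derivative_transform_within_open)
      show "open ?U"
        using open_chart_image[OF c'(1) chart_homeomorphism(2)[OF assms(1)]]
        by (simp add: Int_commute)
      show "cmap c' p \<in> ?U" using c'(2) assms(2) by blast
      show "(u \<circ> cinv c) (?\<tau> x) = (u \<circ> cinv c') x" if "x \<in> ?U" for x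
        using that cinv_cmap[OF c'(1)] cinv_cmap[OF assms(1)] by auto
    qed
    from frechet_derivative_at[OF this, symmetric]
    show ?thesis using True by (simp add: X chart_vector_def v_def)
  next
    case False
    then show ?thesis by (simp add: X chart_vector_def)
  qed
  then show "X \<in> range (chart_vector A c p)" by blast
qed (use chart_vector_tangent[OF assms] in blast)

text \<open>
  Being a critical point does not depend on the chart; this is what allows the local conclusions in
  different charts to be glued.
\<close>

lemma critical_point_chart:
  assumes "smooth_fun A u" "c \<in> A" "p \<in> cdom c"
  shows "(\<forall>X\<in>tangent_space A p. X u = 0) \<longleftrightarrow> egrad (u \<circ> cinv c) (cmap c p) = 0"
proof -
  let ?F = "u \<circ> cinv c"
  have "(\<forall>X\<in>tangent_space A p. X u = 0)
      \<longleftrightarrow> (\<forall>v. frechet_derivative ?F (at (cmap c p)) v = 0)"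
    using smooth_fun_near[OF assms(1), of p]
    by (auto simp: tangent_space_chart[OF assms(2,3)] chart_vector_def)
  also have "\<dots> \<longleftrightarrow> egrad ?F (cmap c p) = 0"
  proof
    assume "\<forall>v. frechet_derivative ?F (at (cmap c p)) v = 0"
    then show "egrad ?F (cmap c p) = 0" by (simp add: egrad_eq_0_iff pd_def)
  next
    assume "egrad ?F (cmap c p) = 0"
    then show "\<forall>v. frechet_derivative ?F (at (cmap c p)) v = 0"
      using frechet_derivative_sum_pd[OF
        smooth_near_differentiable[OF smooth_fun_near[OF assms(1)] assms(2,3)]]
      by (simp add: egrad_eq_0_iff)
  qed
  finally show ?thesis .
qed

text \<open>
  Every point has a neighbourhood on which either no point is critical or all points are, and in the
  latter case \<open>u\<close> is constant there. Hence the critical points at the maximal level form an open and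
  closed set, and the maximum point \<open>p0\<close> belongs to it.
\<close>

theorem constant_if_hessian_locally_dominated:
  assumes u: "smooth_fun A u" and max: "\<And>q. u q \<le> u p0"
    and dom: "\<And>p. \<exists>c\<in>A. \<exists>W C. p \<in> cdom c \<and> open W \<and> cmap c p \<in> W \<and>
       (\<forall>x\<in>W. \<forall>i\<in>Basis. \<forall>j\<in>Basis.
          \<bar>pd i (pd j (u \<circ> cinv c)) x\<bar> \<le> C * norm (egrad (u \<circ> cinv c) x))"
  shows "u constant_on UNIV"
proof -
  define crit where "crit p \<longleftrightarrow> (\<forall>X\<in>tangent_space A p. X u = 0)" for p
  define Z where "Z = {p. crit p \<and> u p = u p0}"
  have nbhd: "\<exists>V. open V \<and> p \<in> V \<and>
      (\<forall>q\<in>V. \<forall>q'\<in>V. crit q \<longrightarrow> crit q' \<and> u q' = u q)" for p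
  proof -
    obtain c W C where c: "c \<in> A" "p \<in> cdom c" and W: "open W" "cmap c p \<in> W"
      and bd: "\<forall>x\<in>W. \<forall>i\<in>Basis. \<forall>j\<in>Basis.
          \<bar>pd i (pd j (u \<circ> cinv c)) x\<bar> \<le> C * norm (egrad (u \<circ> cinv c) x)"
      using dom[of p] by blast
    have "open (W \<inter> cmap c ` cdom c)" "cmap c p \<in> W \<inter> cmap c ` cdom c"
      using W chart_homeomorphism(3)[OF c(1)] c(2) by auto
    then obtain r where r: "r > 0" "ball (cmap c p) r \<subseteq> W \<inter> cmap c ` cdom c"
      using openE by blast
    let ?B = "ball (cmap c p) r"
    let ?V = "cmap c -` ?B \<inter> cdom c"
    have sm: "smooth_on (cmap c ` cdom c) (u \<circ> cinv c)"
      using u c(1) by (auto simp: smooth_fun_def)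
    have "crit q' \<and> u q' = u q" if "q \<in> ?V" "q' \<in> ?V" "crit q" for q q'
    proof -
      have "egrad (u \<circ> cinv c) (cmap c q) = 0"
        using critical_point_chart[OF u c(1)] that by (auto simp: crit_def)
      then have "egrad (u \<circ> cinv c) (cmap c q') = 0"
          "(u \<circ> cinv c) (cmap c q') = (u \<circ> cinv c) (cmap c q)"
        using constant_if_hessian_dominated[OF sm _ convex_ball, of "cmap c p" r C "cmap c q" "cmap c q'"]
          bd that r(2) by blast+
      then show ?thesis
        using critical_point_chart[OF u c(1)] that cinv_cmap[OF c(1)] by (auto simp: crit_def)
    qed
    moreover have "open ?V" "p \<in> ?V"
      using open_chart_preimage[OF c(1)] c(2) r(1) by auto
    ultimately show ?thesis by blast
  qed
  have "p0 \<in> Z"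
  proof -
    obtain c where c: "c \<in> A" "p0 \<in> cdom c" using chart_around by blast
    let ?F = "u \<circ> cinv c"
    have "(?F has_derivative frechet_derivative ?F (at (cmap c p0))) (at (cmap c p0))"
      using smooth_near_differentiable[OF smooth_fun_near[OF u] c]
      by (simp add: frechet_derivative_works[symmetric])
    then have "frechet_derivative ?F (at (cmap c p0)) = (\<lambda>v. 0)"
      by (rule differential_zero_maxmin[of _ UNIV, rotated 2])
        (use max cinv_cmap[OF c] in auto)
    then show ?thesis
      using critical_point_chart[OF u c] by (simp add: Z_def crit_def egrad_eq_0_iff pd_def)
  qed
  moreover have "open Z"
  proof (subst open_subopen, rule ballI)
    fix p assume p: "p \<in> Z"
    obtain V where V: "open V" "p \<in> V"
      and const: "\<And>q q'. q \<in> V \<Longrightarrow> q' \<in> V \<Longrightarrow> crit q \<Longrightarrow> crit q' \<and> u q' = u q"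
      using nbhd[of p] by blast
    have "V \<subseteq> Z"
    proof
      fix q assume "q \<in> V"
      with const[OF V(2) this] p show "q \<in> Z" by (auto simp: Z_def)
    qed
    then show "\<exists>V. open V \<and> p \<in> V \<and> V \<subseteq> Z" using V by blast
  qed
  moreover have "open (- Z)"
  proof (subst open_subopen, rule ballI)
    fix p assume p: "p \<in> - Z"
    obtain V where V: "open V" "p \<in> V"
      and const: "\<And>q q'. q \<in> V \<Longrightarrow> q' \<in> V \<Longrightarrow> crit q \<Longrightarrow> crit q' \<and> u q' = u q"
      using nbhd[of p] by blast
    have "V \<subseteq> - Z"
    proof
      fix q assume "q \<in> V"
      with const[OF this V(2)] p show "q \<in> - Z" by (auto simp: Z_def)
    qed
    then show "\<exists>V. open V \<and> p \<in> V \<and> V \<subseteq> - Z" using V by blast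
  qed
  ultimately have "Z = UNIV"
    using mf connectedD[of UNIV Z "- Z"] unfolding smooth_manifold_def by blast
  then show ?thesis by (auto simp: Z_def constant_on_def)
qed

end


section \<open>Metrics in a chart\<close>

lemma bounded_image_mult:
  fixes \<phi> \<psi> :: "'a \<Rightarrow> real"
  assumes "bounded (\<phi> ` K)" "bounded (\<psi> ` K)"
  shows "bounded ((\<lambda>x. \<phi> x * \<psi> x) ` K)"
proof -
  obtain a b where ab: "\<And>x. x \<in> K \<Longrightarrow> \<bar>\<phi> x\<bar> \<le> a" "\<And>x. x \<in> K \<Longrightarrow> \<bar>\<psi> x\<bar> \<le> b"
    using assms by (auto simp: bounded_iff)
  have "\<bar>\<phi> x * \<psi> x\<bar> \<le> a * b" if "x \<in> K" for x
    unfolding abs_mult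
    using ab[OF that] by (intro mult_mono) (auto intro: order_trans[OF abs_ge_zero])
  then show ?thesis by (auto simp: bounded_iff)
qed

lemma bounded_image_sum:
  fixes \<phi> :: "'i \<Rightarrow> 'a \<Rightarrow> real"
  assumes "finite I" "\<And>i. i \<in> I \<Longrightarrow> bounded (\<phi> i ` K)"
  shows "bounded ((\<lambda>x. \<Sum>i\<in>I. \<phi> i x) ` K)"
  using assms
proof (induction I rule: finite_induct)
  case empty
  show ?case by (rule bounded_subset[of "{0}"]) auto
next
  case (insert i I)
  then show ?case by (simp add: bounded_plus_comp)
qed

context
  fixes A :: "('a::{t2_space, second_countable_topology}, 'e::euclidean_space) chart set"
    and g :: "'a tensor2"
  assumes sr: "semi_riemannian_manifold A g"
begin

lemma semi_riemannian_smooth_manifold: "smooth_manifold A"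
  using sr unfolding semi_riemannian_manifold_def by blast

private lemmas mf = semi_riemannian_smooth_manifold

lemma metric_zero_left:
  assumes "Z \<in> tangent_space A p"
  shows "g p (\<lambda>u. 0) Z = 0"
proof -
  have "g p (\<lambda>u. 0 * Z u + 0 * Z u) Z = 0 * g p Z Z + 0 * g p Z Z"
    using sr assms unfolding semi_riemannian_manifold_def by blast
  then show ?thesis by simp
qed

context
  fixes c assumes c: "c \<in> A"
begin

lemma metric_comp_smooth: "smooth_on (cmap c ` cdom c) (metric_comp A c g v w)"
  using sr c unfolding semi_riemannian_manifold_def by blast

lemma metric_comp_cmap:
  "p \<in> cdom c \<Longrightarrow> metric_comp A c g v w (cmap c p) = g p (chart_vector A c p v) (chart_vector A c p w)"
  by (simp add: metric_comp_def cinv_cmap[OF mf c])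

lemma metric_comp_commute:
  assumes "x \<in> cmap c ` cdom c"
  shows "metric_comp A c g v w x = metric_comp A c g w v x"
proof -
  obtain p where p: "p \<in> cdom c" "x = cmap c p" using assms by blast
  show ?thesis
    using sr chart_vector_tangent[OF mf c p(1)] unfolding semi_riemannian_manifold_def
    by (simp add: p(2) metric_comp_cmap[OF p(1)])
qed

lemma metric_comp_linear:
  assumes "x \<in> cmap c ` cdom c"
  shows "linear (\<lambda>v. metric_comp A c g v w x)"
proof -
  obtain p where p: "p \<in> cdom c" "x = cmap c p" using assms by blast
  have *: "metric_comp A c g (a *\<^sub>R v + b *\<^sub>R v') w x
      = a * metric_comp A c g v w x + b * metric_comp A c g v' w x" for a b v v'
    using sr chart_vector_tangent[OF mf c p(1)] unfolding semi_riemannian_manifold_def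
    by (simp add: p(2) metric_comp_cmap[OF p(1)] chart_vector_linear[OF mf c p(1)])
  show ?thesis
    by (rule linearI) (use *[of 1 _ 1] *[of _ _ 0 0] in auto)
qed

lemma metric_comp_expand:
  assumes "x \<in> cmap c ` cdom c"
  shows "metric_comp A c g v w x = (\<Sum>i\<in>Basis. (v \<bullet> i) * metric_comp A c g i w x)"
proof -
  note lin = metric_comp_linear[OF assms, of w]
  have "metric_comp A c g v w x = metric_comp A c g (\<Sum>i\<in>Basis. (v \<bullet> i) *\<^sub>R i) w x"
    by (simp add: euclidean_representation)
  then show ?thesis
    by (simp add: linear_sum[OF lin] linear_scale[OF lin])
qed

text \<open>
  Nondegeneracy of \<open>g\<close> is a condition on all tangent vectors at \<open>p\<close>, those of other charts included;
  since one chart yields them all, the components in that chart detect it.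
\<close>

lemma metric_comp_nondegenerate:
  assumes "x \<in> cmap c ` cdom c" "\<And>j. j \<in> Basis \<Longrightarrow> metric_comp A c g v j x = 0"
  shows "v = 0"
proof -
  obtain p where p: "p \<in> cdom c" "x = cmap c p" using assms(1) by blast
  let ?X = "chart_vector A c p v"
  have "metric_comp A c g v w x = 0" for w
  proof -
    have "metric_comp A c g v w x = (\<Sum>i\<in>Basis. (w \<bullet> i) * metric_comp A c g i v x)"
      using metric_comp_commute[OF assms(1)] metric_comp_expand[OF assms(1)] by metis
    also have "\<dots> = 0"
    proof (rule sum.neutral, rule ballI)
      fix i :: 'e assume "i \<in> Basis"
      then show "(w \<bullet> i) * metric_comp A c g i v x = 0"
        using assms(2) metric_comp_commute[OF assms(1), of i v] by simp
    qed
    finally show ?thesis .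
  qed
  then have "\<forall>Y\<in>tangent_space A p. g p ?X Y = 0"
    by (auto simp: tangent_space_chart[OF mf c p(1)] p(2) metric_comp_cmap[OF p(1)])
  then have "?X = (\<lambda>u. 0)"
    using sr chart_vector_tangent[OF mf c p(1)] unfolding semi_riemannian_manifold_def by blast
  then have "v \<bullet> i = 0" for i
    using chart_vector_coordinate[OF mf c p(1), of v i] by simp
  then show "v = 0" using inner_eq_zero_iff by blast
qed

text \<open>
  The index-lowering map \<open>v \<mapsto> \<Sum>j. g(v, \<partial>\<^sub>j) j\<close> is injective at each point and depends continuously on
  it, so its norm on unit vectors has a positive minimum over a compact set. This is what bounds the
  inverse metric, and with it the Christoffel symbols.
\<close>

lemma lowering_bounded_below:
  assumes "compact K" "K \<subseteq> cmap c ` cdom c"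
  shows "\<exists>m>0. \<forall>x\<in>K. \<forall>v. m * norm v \<le> norm (\<Sum>j\<in>Basis. metric_comp A c g v j x *\<^sub>R j)"
proof (cases "K = {}")
  case True
  then show ?thesis using zero_less_one by blast
next
  case False
  (* Expanding in the basis makes joint continuity in the point and the vector evident. *)
  define \<Phi> where
    "\<Phi> z = norm (\<Sum>j\<in>Basis. (\<Sum>i\<in>Basis. (snd z \<bullet> i) * metric_comp A c g i j (fst z)) *\<^sub>R j)"
    for z :: "'e \<times> 'e"
  have \<Phi>: "\<Phi> (x, v) = norm (\<Sum>j\<in>Basis. metric_comp A c g v j x *\<^sub>R j)" if "x \<in> K" for x v
    using that assms(2) by (simp add: \<Phi>_def subsetD metric_comp_expand[symmetric])
  have cont: "continuous_on (K \<times> sphere 0 1) (\<lambda>z. metric_comp A c g i j (fst z))" for i j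
    by (rule continuous_on_compose2[OF smooth_on_continuous[OF metric_comp_smooth]])
      (use assms(2) in \<open>auto intro!: continuous_intros\<close>)
  have "continuous_on (K \<times> sphere 0 1) \<Phi>"
    unfolding \<Phi>_def by (intro continuous_intros cont)
  moreover have "compact (K \<times> sphere (0::'e) 1)" "K \<times> sphere (0::'e) 1 \<noteq> {}"
    using assms(1) False by (auto simp: compact_Times sphere_eq_empty)
  ultimately obtain z where z: "z \<in> K \<times> sphere 0 1" "\<forall>y\<in>K \<times> sphere 0 1. \<Phi> z \<le> \<Phi> y"
    using continuous_attains_inf[of "K \<times> sphere 0 1" \<Phi>] by blast
  obtain x0 v0 where "z = (x0, v0)" by fastforce
  with z have z0: "x0 \<in> K" "norm v0 = 1"
    and min: "\<And>x v. x \<in> K \<Longrightarrow> norm v = 1 \<Longrightarrow> \<Phi> (x0, v0) \<le> \<Phi> (x, v)"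
    by auto
  let ?m = "\<Phi> (x0, v0)"
  have "?m > 0"
  proof (rule ccontr)
    assume "\<not> ?m > 0"
    then have 0: "(\<Sum>j\<in>Basis. metric_comp A c g v0 j x0 *\<^sub>R j) = 0"
      by (simp add: \<Phi>[OF z0(1)])
    have "metric_comp A c g v0 k x0 = 0" if "k \<in> Basis" for k
      using arg_cong[OF 0, of "\<lambda>y. y \<bullet> k"] that by simp
    then have "v0 = 0" using metric_comp_nondegenerate z0(1) assms(2) by blast
    then show False using z0(2) by simp
  qed
  moreover have "?m * norm v \<le> norm (\<Sum>j\<in>Basis. metric_comp A c g v j x *\<^sub>R j)"
    if "x \<in> K" for x v
  proof (cases "v = 0")
    case False
    let ?e = "inverse (norm v) *\<^sub>R v"
    have x: "x \<in> cmap c ` cdom c" using that assms(2) by blast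
    have "?m \<le> \<Phi> (x, ?e)"
      using False by (intro min that) simp
    also have "\<dots> = norm (inverse (norm v) *\<^sub>R (\<Sum>j\<in>Basis. metric_comp A c g v j x *\<^sub>R j))"
      unfolding \<Phi>[OF that] linear_scale[OF metric_comp_linear[OF x]]
      by (simp add: scaleR_sum_right)
    finally show ?thesis using False by (simp add: field_simps)
  qed auto
  ultimately show ?thesis by blast
qed

lemma metric_inv_bounded:
  assumes "compact K" "K \<subseteq> cmap c ` cdom c" "k \<in> Basis"
  shows "bounded (metric_inv A c g k l ` K)"
proof -
  obtain m where m: "m > 0" and le: "\<And>x v. x \<in> K \<Longrightarrow>
      m * norm v \<le> norm (\<Sum>j\<in>Basis. metric_comp A c g v j x *\<^sub>R j)"
    using lowering_bounded_below[OF assms(1,2)] by blast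
  have "\<bar>metric_inv A c g k l x\<bar> \<le> norm l / m" if x: "x \<in> K" for x
  proof -
    let ?L = "\<lambda>v. \<Sum>j\<in>Basis. metric_comp A c g v j x *\<^sub>R j"
    have xI: "x \<in> cmap c ` cdom c" using x assms(2) by blast
    have lin: "linear ?L"
      by (intro linearI)
        (simp_all add: linear_add[OF metric_comp_linear[OF xI]] scaleR_add_left sum.distrib
          linear_scale[OF metric_comp_linear[OF xI]] scaleR_sum_right)
    have "inj ?L"
      unfolding linear_injective_0[OF lin]
    proof (intro allI impI)
      fix v assume "?L v = 0"
      then have "m * norm v \<le> 0" using le[OF x, of v] by simp
      then show "v = 0" using m by (simp add: mult_le_0_iff)
    qed
    then have "?L (inv ?L l) = l"
      by (intro surj_f_inv_f[of ?L] linear_inj_imp_surj[OF lin])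
    then have "m * norm (inv ?L l) \<le> norm l"
      using le[OF x, of "inv ?L l"] by simp
    then have "norm (inv ?L l) \<le> norm l / m"
      using m by (simp add: pos_le_divide_eq mult.commute)
    then show ?thesis
      using Basis_le_norm[OF assms(3), of "inv ?L l"] unfolding metric_inv_def by linarith
  qed
  then show ?thesis by (auto simp: bounded_iff)
qed

lemma christoffel_bounded:
  assumes "compact K" "K \<subseteq> cmap c ` cdom c" "k \<in> Basis"
  shows "bounded (christoffel A c g k i j ` K)"
proof -
  have pd: "bounded (pd l (metric_comp A c g v w) ` K)" for l v w
    using smooth_on_continuous[OF smooth_on_pd[OF metric_comp_smooth]] assms(1,2)
    by (meson compact_continuous_image compact_imp_bounded continuous_on_subset)
  have const: "bounded ((\<lambda>x. 1 / 2 :: real) ` K)"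
    by (rule bounded_subset[of "{1 / 2}"]) auto
  show ?thesis
    unfolding christoffel_def[abs_def]
    by (intro bounded_image_mult bounded_image_sum const finite_Basis
        metric_inv_bounded[OF assms] bounded_minus_comp bounded_plus_comp pd)
qed

lemma hessian_chart_vector:
  assumes "p \<in> cdom c"
  shows "hessian A c g u p (chart_vector A c p v) (chart_vector A c p w) =
     (\<Sum>i\<in>Basis. \<Sum>j\<in>Basis. (v \<bullet> i) * (w \<bullet> j) * (pd i (pd j (u \<circ> cinv c)) (cmap c p)
        - (\<Sum>k\<in>Basis. christoffel A c g k i j (cmap c p) * pd k (u \<circ> cinv c) (cmap c p))))"
  by (simp add: hessian_def chart_vector_coordinate[OF mf c assms])

lemma hessian_chart_vector_Basis:
  assumes "p \<in> cdom c" "i \<in> Basis" "j \<in> Basis"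
  shows "hessian A c g u p (chart_vector A c p i) (chart_vector A c p j) =
     pd i (pd j (u \<circ> cinv c)) (cmap c p)
        - (\<Sum>k\<in>Basis. christoffel A c g k i j (cmap c p) * pd k (u \<circ> cinv c) (cmap c p))"
proof -
  have *: "(\<Sum>i'\<in>Basis. \<Sum>j'\<in>Basis. (i \<bullet> i') * (j \<bullet> j') * a i' j') = a i j" for a :: "'e \<Rightarrow> 'e \<Rightarrow> real"
  proof -
    have "(\<Sum>i'\<in>Basis. \<Sum>j'\<in>Basis. (i \<bullet> i') * (j \<bullet> j') * a i' j')
      = (\<Sum>i'\<in>Basis. \<Sum>j'\<in>Basis. if i' = i then if j' = j then a i j else 0 else 0)"
      using assms(2,3) by (intro sum.cong refl) (auto simp: inner_Basis)
    also have "\<dots> = (\<Sum>i'\<in>Basis. if i' = i then a i j else 0)"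
      using assms(3) by (intro sum.cong refl) auto
    also have "\<dots> = a i j" using assms(2) by simp
    finally show ?thesis .
  qed
  show ?thesis
    unfolding hessian_chart_vector[OF assms(1)] by (rule *)
qed

text \<open>
  Evaluated on \<open>(v, w)\<close>, the equation \<open>\<sigma> g = Hess u\<close> loses its second-order part by the assumption
  \<open>flat\<close>. Division by \<open>g(v, w)\<close>, which stays away from 0 near \<open>p\<close>, bounds \<open>\<sigma>\<close> by the first derivatives
  of \<open>u\<close>; on pairs of basis vectors the same equation then bounds the second derivatives.
\<close>

theorem conformal_hessian_dominated:
  assumes u: "smooth_fun A u" and p: "p \<in> cdom c"
    and conf: "\<And>q X Y. q \<in> cdom c \<Longrightarrow> X \<in> tangent_space A q \<Longrightarrow> Y \<in> tangent_space A q
        \<Longrightarrow> \<sigma> q * g q X Y = hessian A c g u q X Y"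
    and flat: "\<And>x. x \<in> cmap c ` cdom c \<Longrightarrow>
        (\<Sum>i\<in>Basis. \<Sum>j\<in>Basis. (v \<bullet> i) * (w \<bullet> j) * pd i (pd j (u \<circ> cinv c)) x) = 0"
    and vw: "metric_comp A c g v w (cmap c p) \<noteq> 0"
  shows "\<exists>W C. open W \<and> cmap c p \<in> W \<and> (\<forall>x\<in>W. \<forall>i\<in>Basis. \<forall>j\<in>Basis.
     \<bar>pd i (pd j (u \<circ> cinv c)) x\<bar> \<le> C * norm (egrad (u \<circ> cinv c) x))"
proof -
  let ?F = "u \<circ> cinv c" and ?I = "cmap c ` cdom c" and ?n = "real DIM('e)"
  define \<epsilon> where "\<epsilon> = \<bar>metric_comp A c g v w (cmap c p)\<bar> / 2"
  have \<epsilon>: "\<epsilon> > 0" using vw by (simp add: \<epsilon>_def)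
  have "open (?I \<inter> (\<lambda>x. \<bar>metric_comp A c g v w x\<bar>) -` {\<epsilon><..})"
    by (intro continuous_open_preimage chart_homeomorphism(3)[OF mf c] open_greaterThan
        continuous_on_rabs smooth_on_continuous metric_comp_smooth)
  moreover have "cmap c p \<in> ?I \<inter> (\<lambda>x. \<bar>metric_comp A c g v w x\<bar>) -` {\<epsilon><..}"
    using p vw by (simp add: \<epsilon>_def)
  ultimately obtain r where r: "r > 0"
    and "cball (cmap c p) r \<subseteq> ?I \<inter> (\<lambda>x. \<bar>metric_comp A c g v w x\<bar>) -` {\<epsilon><..}"
    using open_contains_cball by metis
  then have K: "cball (cmap c p) r \<subseteq> ?I"
    and vw_ge: "\<And>x. x \<in> cball (cmap c p) r \<Longrightarrow> \<epsilon> \<le> \<bar>metric_comp A c g v w x\<bar>"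
    by (auto simp: less_imp_le)
  let ?K = "cball (cmap c p) r"
  have "bounded (\<Union>i\<in>Basis. \<Union>j\<in>Basis. \<Union>k\<in>Basis. christoffel A c g k i j ` ?K)"
    using christoffel_bounded[OF compact_cball K] by (intro bounded_UN ballI finite_Basis) auto
  then obtain M where M: "M > 0" "\<And>x i j k. x \<in> ?K \<Longrightarrow> i \<in> Basis \<Longrightarrow> j \<in> Basis \<Longrightarrow> k \<in> Basis
      \<Longrightarrow> \<bar>christoffel A c g k i j x\<bar> \<le> M"
    unfolding bounded_pos by fastforce
  have "bounded (metric_comp A c g i j ` ?K)" for i j
    using smooth_on_continuous[OF metric_comp_smooth] K
    by (meson compact_cball compact_continuous_image compact_imp_bounded continuous_on_subset)
  then have "bounded (\<Union>i\<in>Basis. \<Union>j\<in>Basis. metric_comp A c g i j ` ?K)"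
    by (intro bounded_UN ballI finite_Basis) auto
  then obtain N where N: "N > 0" "\<And>x i j. x \<in> ?K \<Longrightarrow> i \<in> Basis \<Longrightarrow> j \<in> Basis
      \<Longrightarrow> \<bar>metric_comp A c g i j x\<bar> \<le> N"
    unfolding bounded_pos by fastforce
  (* ?n * M bounds the Christoffel terms; the other factor adds the contribution of \<sigma> g, where
     |\<sigma>| is estimated by summing the Christoffel terms over all pairs and dividing by \<epsilon>. *)
  define C where "C = (?n * ?n * norm v * norm w / \<epsilon> * N + 1) * (?n * M)"
  have "\<bar>pd i (pd j ?F) x\<bar> \<le> C * norm (egrad ?F x)"
    if x: "x \<in> ?K" and ij: "i \<in> Basis" "j \<in> Basis" for x i j
  proof -
    obtain q where q: "q \<in> cdom c" "x = cmap c q" using x K by blast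
    define b where "b i j = (\<Sum>k\<in>Basis. christoffel A c g k i j x * pd k ?F x)" for i j
    let ?Q = "?n * M * norm (egrad ?F x)"
    have b: "\<bar>b i j\<bar> \<le> ?Q" if "i \<in> Basis" "j \<in> Basis" for i j
    proof -
      have "\<bar>b i j\<bar> \<le> (\<Sum>k\<in>Basis. \<bar>christoffel A c g k i j x * pd k ?F x\<bar>)"
        unfolding b_def by (rule sum_abs)
      also have "\<dots> \<le> (\<Sum>k\<in>(Basis::'e set). M * norm (egrad ?F x))"
      proof (rule sum_mono)
        fix k :: 'e assume k: "k \<in> Basis"
        have "\<bar>pd k ?F x\<bar> \<le> norm (egrad ?F x)"
          using Basis_le_norm[OF k, of "egrad ?F x"] by (simp add: egrad_component[OF k])
        then show "\<bar>christoffel A c g k i j x * pd k ?F x\<bar> \<le> M * norm (egrad ?F x)"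
          unfolding abs_mult using M(1) M(2)[OF x that k] by (intro mult_mono) auto
      qed
      finally show ?thesis by simp
    qed
    have eq: "\<sigma> q * metric_comp A c g i j x = pd i (pd j ?F) x - b i j"
      if "i \<in> Basis" "j \<in> Basis" for i j
      using conf[OF q(1) chart_vector_tangent[OF mf c q(1), of i] chart_vector_tangent[OF mf c q(1), of j]]
      unfolding hessian_chart_vector_Basis[OF q(1) that]
      by (simp add: q(2) metric_comp_cmap[OF q(1)] b_def)
    have "\<sigma> q * metric_comp A c g v w x =
        (\<Sum>i\<in>Basis. \<Sum>j\<in>Basis. (v \<bullet> i) * (w \<bullet> j) * (pd i (pd j ?F) x - b i j))"
      using conf[OF q(1) chart_vector_tangent[OF mf c q(1), of v] chart_vector_tangent[OF mf c q(1), of w]]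
      unfolding hessian_chart_vector[OF q(1)]
      by (simp add: q(2) metric_comp_cmap[OF q(1)] b_def)
    also have "\<dots> = - (\<Sum>i\<in>Basis. \<Sum>j\<in>Basis. (v \<bullet> i) * (w \<bullet> j) * b i j)"
      using flat[of x] x K by (simp add: right_diff_distrib sum_subtractf subset_iff)
    also have "\<bar>\<dots>\<bar> \<le> (\<Sum>i\<in>Basis. \<bar>\<Sum>j\<in>Basis. (v \<bullet> i) * (w \<bullet> j) * b i j\<bar>)"
      using sum_abs by simp
    also have "\<dots> \<le> (\<Sum>i\<in>(Basis::'e set). \<Sum>j\<in>(Basis::'e set). norm v * norm w * ?Q)"
    proof (intro sum_mono order_trans[OF sum_abs])
      fix i j :: 'e assume ij: "i \<in> Basis" "j \<in> Basis"
      show "\<bar>(v \<bullet> i) * (w \<bullet> j) * b i j\<bar> \<le> norm v * norm w * ?Q"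
        unfolding abs_mult
        using Basis_le_norm[OF ij(1), of v] Basis_le_norm[OF ij(2), of w] b[OF ij]
        by (intro mult_mono) auto
    qed
    also have "\<dots> = ?n * ?n * norm v * norm w * ?Q" by simp
    finally have "\<bar>\<sigma> q\<bar> * \<bar>metric_comp A c g v w x\<bar> \<le> ?n * ?n * norm v * norm w * ?Q"
      by (simp add: abs_mult)
    moreover have "\<bar>\<sigma> q\<bar> * \<epsilon> \<le> \<bar>\<sigma> q\<bar> * \<bar>metric_comp A c g v w x\<bar>"
      using vw_ge[OF x] by (intro mult_left_mono) auto
    ultimately have "\<bar>\<sigma> q\<bar> \<le> ?n * ?n * norm v * norm w * ?Q / \<epsilon>"
      using \<epsilon> by (simp add: pos_le_divide_eq)
    then have "\<bar>\<sigma> q * metric_comp A c g i j x\<bar> \<le> ?n * ?n * norm v * norm w * ?Q / \<epsilon> * N"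
      unfolding abs_mult using N(2)[OF x ij] by (intro mult_mono) auto
    then have "\<bar>pd i (pd j ?F) x\<bar> \<le> ?n * ?n * norm v * norm w * ?Q / \<epsilon> * N + ?Q"
      using eq[OF ij] b[OF ij] by linarith
    also have "\<dots> = C * norm (egrad ?F x)"
      by (simp add: C_def algebra_simps)
    finally show ?thesis .
  qed
  then have "\<forall>x\<in>ball (cmap c p) r. \<forall>i\<in>Basis. \<forall>j\<in>Basis.
      \<bar>pd i (pd j ?F) x\<bar> \<le> C * norm (egrad ?F x)"
    using ball_subset_cball by blast
  then show ?thesis
    using r by (intro exI[of _ "ball (cmap c p) r"] exI[of _ C]) simp
qed

end

end

section \<open>Vertical vectors of the product\<close>

context
  fixes AB :: "('b::{t2_space, second_countable_topology}, 'e::euclidean_space) chart set"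
    and AF :: "('f::{t2_space, second_countable_topology}, 'd::euclidean_space) chart set"
  assumes mfB: "smooth_manifold AB" and mfF: "smooth_manifold AF"
    and mfP: "smooth_manifold (product_atlas AB AF)"
begin

lemma cdom_product_chart [simp]: "cdom (product_chart c c') = cdom c \<times> cdom c'"
  and cmap_product_chart [simp]: "cmap (product_chart c c') = map_prod (cmap c) (cmap c')"
  by (simp_all add: product_chart_def)

lemma product_chart_in_atlas:
  "c \<in> AB \<Longrightarrow> c' \<in> AF \<Longrightarrow> product_chart c c' \<in> product_atlas AB AF"
  unfolding product_atlas_def by blast

lemma cinv_product_chart:
  assumes "c \<in> AB" "c' \<in> AF" "z \<in> cmap (product_chart c c') ` cdom (product_chart c c')"
  shows "cinv (product_chart c c') z = (cinv c (fst z), cinv c' (snd z))"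
proof -
  obtain p q where "p \<in> cdom c" "q \<in> cdom c'" "z = cmap (product_chart c c') (p, q)"
    using assms(3) by auto
  then show ?thesis
    using cinv_cmap[OF mfP product_chart_in_atlas[OF assms(1,2)], of "(p, q)"]
      cinv_cmap[OF mfB assms(1)] cinv_cmap[OF mfF assms(2)] by simp
qed

lemma pd_vertical_fst:
  assumes "c \<in> AB" "c' \<in> AF" and z: "z \<in> cmap (product_chart c c') ` cdom (product_chart c c')"
    and "(u \<circ> fst \<circ> cinv (product_chart c c')) differentiable (at z)"
  shows "pd (0, a) (u \<circ> fst \<circ> cinv (product_chart c c')) z = 0"
  using chart_homeomorphism(3)[OF mfP product_chart_in_atlas[OF assms(1,2)]] z assms(4)
proof (rule pd_zero_if_constant_in_direction)
  fix t :: real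
  assume "z + t *\<^sub>R (0, a) \<in> cmap (product_chart c c') ` cdom (product_chart c c')"
  from cinv_product_chart[OF assms(1,2) this] cinv_product_chart[OF assms(1,2) z]
  show "(u \<circ> fst \<circ> cinv (product_chart c c')) (z + t *\<^sub>R (0, a))
      = (u \<circ> fst \<circ> cinv (product_chart c c')) z"
    by simp
qed

text \<open>
  If \<open>u \<circ> fst\<close> is not smooth near the point, the coordinate vector takes its default value 0 on it, so
  the two sides agree in this case as well.
\<close>

lemma differential_fst_vertical:
  assumes "c \<in> AB" "c' \<in> AF" "p \<in> cdom c" "q \<in> cdom c'"
  shows "differential AB fst (p, q)
    (chart_vector (product_atlas AB AF) (product_chart c c') (p, q) (0, a)) = (\<lambda>u. 0)"
proof
  fix u
  let ?C = "product_chart c c'"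
  have pq: "(p, q) \<in> cdom ?C" using assms by simp
  then have "pd (0, a) (u \<circ> fst \<circ> cinv ?C) (cmap ?C (p, q)) = 0"
    if "smooth_near (product_atlas AB AF) (p, q) (u \<circ> fst)"
    by (intro pd_vertical_fst[OF assms(1,2)] imageI
        smooth_near_differentiable[OF mfP that product_chart_in_atlas[OF assms(1,2)]])
  then show "differential AB fst (p, q) (chart_vector (product_atlas AB AF) ?C (p, q) (0, a)) u = 0"
    by (simp add: differential_def chart_vector_def pd_def)
qed

text \<open>
  A tangent vector of the product vanishes by convention on functions that are not smooth, so
  the differential of \<open>snd\<close> can be computed on a function of the second factor only once its lift is known to be smooth.
\<close>

lemma smooth_near_snd:
  assumes "smooth_near AF q u"
  shows "smooth_near (product_atlas AB AF) (p, q) (u \<circ> snd)"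
proof -
  obtain N where N: "open N" "q \<in> N"
    and sm: "\<And>c'. c' \<in> AF \<Longrightarrow> smooth_on (cmap c' ` (N \<inter> cdom c')) (u \<circ> cinv c')"
    using assms unfolding smooth_near_def by blast
  have oN: "open (UNIV \<times> N :: ('b \<times> 'f) set)"
    using N(1) by (intro open_Times) auto
  have "smooth_on (cmap C ` (UNIV \<times> N \<inter> cdom C)) (u \<circ> snd \<circ> cinv C)"
    if CA: "C \<in> product_atlas AB AF" for C
  proof -
    obtain c c' where C: "C = product_chart c c'" and cc: "c \<in> AB" "c' \<in> AF"
      using CA unfolding product_atlas_def by blast
    let ?T = "cmap C ` (UNIV \<times> N \<inter> cdom C)"
    have oT: "open ?T" by (rule open_chart_image[OF mfP CA oN])
    have "Ck_on k (u \<circ> snd \<circ> cinv C) ?T" for k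
    proof (rule Ck_on_cong[OF oT])
      show "Ck_on k (\<lambda>z. (u \<circ> cinv c') (snd z)) ?T"
      proof (rule Ck_on_linear_right[OF bounded_linear_snd oT])
        show "snd ` ?T \<subseteq> cmap c' ` (N \<inter> cdom c')" by (auto simp: C)
        show "Ck_on k (u \<circ> cinv c') (cmap c' ` (N \<inter> cdom c'))"
          using sm[OF cc(2)] by (simp add: smooth_on_def)
      qed
      show "(u \<circ> cinv c') (snd z) = (u \<circ> snd \<circ> cinv C) z" if "z \<in> ?T" for z
      proof -
        have "z \<in> cmap C ` cdom C" using that by blast
        then show ?thesis using cinv_product_chart[OF cc, of z] by (simp add: C)
      qed
    qed
    then show ?thesis by (simp add: smooth_on_def)
  qed
  then show ?thesis
    using oN N(2) unfolding smooth_near_def by (intro exI[of _ "UNIV \<times> N"]) auto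
qed

lemma differential_snd_vertical:
  assumes "c \<in> AB" "c' \<in> AF" "p \<in> cdom c" "q \<in> cdom c'"
  shows "differential AF snd (p, q)
    (chart_vector (product_atlas AB AF) (product_chart c c') (p, q) (0, a)) = chart_vector AF c' q a"
proof
  fix u
  let ?C = "product_chart c c'"
  show "differential AF snd (p, q)
      (chart_vector (product_atlas AB AF) ?C (p, q) (0, a)) u = chart_vector AF c' q a u"
  proof (cases "smooth_near AF q u")
    case True
    let ?D = "frechet_derivative (u \<circ> cinv c') (at (cmap c' q))"
    have "((u \<circ> cinv c') has_derivative ?D) (at (snd (cmap ?C (p, q))))"
      using smooth_near_differentiable[OF mfF True assms(2,4)]
      by (simp add: frechet_derivative_works[symmetric])
    from has_derivative_compose[OF bounded_linear_imp_has_derivative[OF bounded_linear_snd] this]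
    have "((\<lambda>z. (u \<circ> cinv c') (snd z)) has_derivative (\<lambda>v. ?D (snd v))) (at (cmap ?C (p, q)))" .
    then have "((u \<circ> snd \<circ> cinv ?C) has_derivative (\<lambda>v. ?D (snd v))) (at (cmap ?C (p, q)))"
      by (rule has_derivative_transform_within_open
          [OF _ chart_homeomorphism(3)[OF mfP product_chart_in_atlas[OF assms(1,2)]]])
        (use assms cinv_product_chart[OF assms(1,2)] in auto)
    from frechet_derivative_at[OF this, symmetric] show ?thesis
      using True smooth_near_snd[OF True, of p] by (simp add: differential_def chart_vector_def)
  next
    case False
    then show ?thesis by (simp add: differential_def chart_vector_def)
  qed
qed

text \<open>
  Vertical vectors project to 0 in \<open>B\<close>, and a metric vanishes on the zero vector.
\<close>

lemma warped_metric_comp_vertical: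
  assumes gB: "semi_riemannian_manifold AB gB"
    and c: "c \<in> AB" "c' \<in> AF" "p \<in> cdom c" "q \<in> cdom c'"
  shows "metric_comp (product_atlas AB AF) (product_chart c c') (warped_metric AB AF gB f gF)
      (0, a) (0, b) (cmap (product_chart c c') (p, q))
    = (f p)\<^sup>2 * metric_comp AF c' gF a b (cmap c' q)"
proof -
  have "(\<lambda>u. 0) \<in> tangent_space AB p"
    using chart_vector_tangent[OF mfB c(1,3), of 0] chart_vector_linear[OF mfB c(1,3), of 0 0 0 0]
    by simp
  from metric_zero_left[OF gB this] show ?thesis
    using cinv_cmap[OF mfP product_chart_in_atlas[OF c(1,2)], of "(p, q)"] cinv_cmap[OF mfF c(2,4)] c
    by (simp add: metric_comp_def warped_metric_def pullback_def differential_fst_vertical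
        differential_snd_vertical del: cmap_product_chart)
qed

lemma second_derivative_vertical_fst:
  assumes "smooth_fun (product_atlas AB AF) (h \<circ> fst)" "c \<in> AB" "c' \<in> AF"
    and x: "x \<in> cmap (product_chart c c') ` cdom (product_chart c c')"
  shows "(\<Sum>i\<in>Basis. \<Sum>j\<in>Basis. ((0, a) \<bullet> i) * ((0, b) \<bullet> j) *
    pd i (pd j (h \<circ> fst \<circ> cinv (product_chart c c'))) x) = 0"
proof (intro sum.neutral ballI)
  let ?C = "product_chart c c'"
  let ?F = "h \<circ> fst \<circ> cinv ?C" and ?I = "cmap ?C ` cdom ?C"
  fix i j :: "'e \<times> 'd" assume "i \<in> Basis" "j \<in> Basis"
  then consider "(0, b) \<bullet> j = 0" | j' where "j = (0, j')"
    by (auto simp: Basis_prod_def)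
  then show "((0, a) \<bullet> i) * ((0, b) \<bullet> j) * pd i (pd j ?F) x = 0"
  proof cases
    case 2
    have sm: "smooth_on ?I ?F"
      using assms(1) product_chart_in_atlas[OF assms(2,3)] unfolding smooth_fun_def by blast
    have "0 = pd j ?F z" if "z \<in> ?I" for z
      unfolding 2
      by (rule pd_vertical_fst[symmetric]) (use assms that smooth_on_differentiable[OF sm] in auto)
    then have "frechet_derivative (\<lambda>z. 0) (at x) = frechet_derivative (pd j ?F) (at x)"
      using x by (intro frechet_derivative_transform_within_open[of _ x ?I]
          chart_homeomorphism(3)[OF mfP product_chart_in_atlas[OF assms(2,3)]]) auto
    from fun_cong[OF this, of i] have "pd i (pd j ?F) x = 0"
      by (simp add: pd_def[of i])
    then show ?thesis by simp
  qed simp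
qed

end

theorem theorem1p3:
  fixes AB :: "('b::{t2_space, second_countable_topology}, 'e::euclidean_space) chart set"
    and AF :: "('f::{t2_space, second_countable_topology}, 'd::euclidean_space) chart set"
    and gB :: "'b tensor2" and gF :: "'f tensor2"
    and f h :: "'b \<Rightarrow> real"
    and lambda_F \<rho> :: real
  assumes "riemannian_manifold AB gB" and "compact (UNIV :: 'b set)"
    and "semi_riemannian_manifold AF gF" and "constant_scalar_curvature AF gF lambda_F"
    and "smooth_fun AB f" and "\<And>x. f x > 0"
    and "smooth_fun AB h"
    and "gradient_yamabe_soliton (product_atlas AB AF) (warped_metric AB AF gB f gF) (h \<circ> fst) \<rho>"
  shows "trivial_potential (h \<circ> fst :: 'b \<times> 'f \<Rightarrow> real)"
proof -
  let ?A = "product_atlas AB AF" and ?g = "warped_metric AB AF gB f gF"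
  have srB: "semi_riemannian_manifold AB gB"
    using assms(1) by (simp add: riemannian_manifold_def)
  have srP: "semi_riemannian_manifold ?A ?g" and sm: "smooth_fun ?A (h \<circ> fst)"
    and sol: "\<And>c p X Y. c \<in> ?A \<Longrightarrow> p \<in> cdom c \<Longrightarrow> X \<in> tangent_space ?A p \<Longrightarrow>
        Y \<in> tangent_space ?A p \<Longrightarrow>
        (scalar_curvature ?A c ?g p - \<rho>) * ?g p X Y = hessian ?A c ?g (h \<circ> fst) p X Y"
    using assms(8) unfolding gradient_yamabe_soliton_def by blast+
  note mfB = semi_riemannian_smooth_manifold[OF srB]
    and mfF = semi_riemannian_smooth_manifold[OF assms(3)]
    and mfP = semi_riemannian_smooth_manifold[OF srP]
  obtain p0 where p0: "\<And>p. h p \<le> h p0"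
    using continuous_attains_sup[OF assms(2) _ smooth_fun_continuous[OF mfB assms(7)]] by auto
  have "(h \<circ> fst :: 'b \<times> 'f \<Rightarrow> real) constant_on UNIV"
  proof (rule constant_if_hessian_locally_dominated[OF mfP sm])
    show "(h \<circ> fst) z \<le> (h \<circ> fst) (p0, undefined)" for z :: "'b \<times> 'f"
      using p0 by simp
    fix z :: "'b \<times> 'f"
    obtain p q where z: "z = (p, q)" by fastforce
    obtain c c' where c: "c \<in> AB" "p \<in> cdom c" "c' \<in> AF" "q \<in> cdom c'"
      using chart_around[OF mfB] chart_around[OF mfF] by metis
    let ?C = "product_chart c c'"
    have C: "?C \<in> ?A" "z \<in> cdom ?C"
      using c product_chart_in_atlas[OF mfB mfF mfP] by (auto simp: z product_chart_def)
    (* The frame vector a is not in the kernel of the fibre metric, so some b pairs with it. *)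
    obtain a :: 'd where a: "a \<in> Basis" by (meson nonempty_Basis ex_in_conv)
    have "\<exists>b\<in>Basis. metric_comp AF c' gF a b (cmap c' q) \<noteq> 0"
      using metric_comp_nondegenerate[OF assms(3) c(3), of "cmap c' q" a] c(4) a nonzero_Basis
      by blast
    then obtain b where b: "metric_comp AF c' gF a b (cmap c' q) \<noteq> 0" by blast
    have "\<exists>W C. open W \<and> cmap ?C z \<in> W \<and> (\<forall>x\<in>W. \<forall>i\<in>Basis. \<forall>j\<in>Basis.
       \<bar>pd i (pd j (h \<circ> fst \<circ> cinv ?C)) x\<bar> \<le> C * norm (egrad (h \<circ> fst \<circ> cinv ?C) x))"
    proof (rule conformal_hessian_dominated[OF srP C(1) sm C(2) sol[OF C(1)]])
      show "(\<Sum>i\<in>Basis. \<Sum>j\<in>Basis. ((0, a) \<bullet> i) * ((0, b) \<bullet> j) *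
          pd i (pd j (h \<circ> fst \<circ> cinv ?C)) x) = 0" if "x \<in> cmap ?C ` cdom ?C" for x
        by (rule second_derivative_vertical_fst[OF mfB mfF mfP sm c(1,3) that])
      show "metric_comp ?A ?C ?g (0, a) (0, b) (cmap ?C z) \<noteq> 0"
        unfolding z warped_metric_comp_vertical[OF mfB mfF mfP srB c(1,3,2,4)]
        using b assms(6)[of p] by simp
    qed
    then show "\<exists>c\<in>?A. \<exists>W C. z \<in> cdom c \<and> open W \<and> cmap c z \<in> W \<and>
       (\<forall>x\<in>W. \<forall>i\<in>Basis. \<forall>j\<in>Basis.
          \<bar>pd i (pd j (h \<circ> fst \<circ> cinv c)) x\<bar> \<le> C * norm (egrad (h \<circ> fst \<circ> cinv c) x))"
      using C by blast
  qed
  then show ?thesis by (simp add: trivial_potential_def)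
qed

end
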